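(* Let $D$ be a strongly connected digraph with $n \geq 4$ vertices such that for any two adjacent vertices $x$ and $y$ of $D$ the inequality $\deg(x)+\deg(y)\geq n+1$ holds. Then $D$ has a noncritical vertex.
   Context: Digraphs are finite, without loops and without multiple arcs: any two distinct vertices $x$ and $y$ are connected by at most two arcs, at most one in each direction (both arcs $xy$ and $yx$ may be present simultaneously). Two distinct vertices are adjacent if there is at least one arc between them, in either direction. A digraph is strongly connected if for any two of its vertices $x,y$ there is a directed path from $x$ to $y$. The degree $\deg(x)$ of a vertex $x$ in $D$ is the number of vertices adjacent to $x$; if $x$ and $y$ are connected by two arcs, then $y$ is counted once. $D-v$ denotes the digraph obtained from $D$ by deleting the vertex $v$ and all arcs incident to $v$. A vertex $v$ of a strongly connected digraph $D$ is called noncritical if the digraph $D-v$ is strongly connected. *)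

theory Defs
  imports "Graph_Theory.Digraph_Component"
begin

definition adjacent :: "('a, 'b) pre_digraph \<Rightarrow> 'a \<Rightarrow> 'a \<Rightarrow> bool" where
  "adjacent D x y \<longleftrightarrow>
     x \<in> verts D \<and> y \<in> verts D \<and> x \<noteq> y \<and> (x \<rightarrow>\<^bsub>D\<^esub> y \<or> y \<rightarrow>\<^bsub>D\<^esub> x)"

text \<open>The degree counts neighbours, not arcs: a pair of opposite arcs contributes one, so this
  differs from the sum of \<^const>\<open>in_degree\<close> and \<^const>\<open>out_degree\<close>.\<close>

definition vdeg :: "('a, 'b) pre_digraph \<Rightarrow> 'a \<Rightarrow> nat" where
  "vdeg D x = card {y. adjacent D x y}"

definition noncritical :: "('a, 'b) pre_digraph \<Rightarrow> 'a \<Rightarrow> bool" where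
  "noncritical D v \<longleftrightarrow> v \<in> verts D \<and> strongly_connected (pre_digraph.del_vert D v)"

end

theory Submission
  imports Defs
begin

text \<open>Let \<open>H\<close> be a strongly connected proper induced subdigraph of maximum order and attach to it a
  shortest ear; by maximality its inner vertices \<open>p\<^sub>1, \<dots>, p\<^sub>k\<close> are all the vertices outside \<open>H\<close>, and by
  minimality it has no forward shortcuts. If \<open>k = 1\<close>, the vertex \<open>p\<^sub>1\<close> is noncritical. If \<open>k \<ge> 4\<close>, then
  \<open>p\<^sub>2\<close> and \<open>p\<^sub>3\<close> have no neighbours in \<open>H\<close> and their common neighbours lie in a strongly connected
  proper subdigraph, so the degree sum is at most \<open>k + |H| = n\<close>. If \<open>k = 3\<close>, then \<open>p\<^sub>2\<close> has degree 2,
  so \<open>p\<^sub>1\<close> and \<open>p\<^sub>3\<close> are adjacent to everything and every vertex of \<open>H\<close> is noncritical. If \<open>k = 2\<close>,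
  let \<open>a\<close> vertices of \<open>H\<close> have an arc to \<open>p\<^sub>1\<close> and \<open>b\<close> receive one from \<open>p\<^sub>2\<close>; the degree condition
  gives \<open>a + b > |H|\<close>. A spanning out-tree rooted at \<open>p\<^sub>2\<close> can be chosen with at least \<open>b\<close> leaves in \<open>H\<close>,
  and a spanning in-tree rooted at \<open>p\<^sub>1\<close> with at least \<open>a\<close>, so some vertex is a leaf of both, and
  deleting it preserves strong connectivity.\<close>

section \<open>Strong connectivity and ears for a bare arc relation\<close>

text \<open>With a fixed relation \<open>E\<close> and a varying \<open>X\<close>, deleting vertices
  is a set difference and reversing all arcs is taking the converse relation.\<close>

definition strong_on :: "('a \<times> 'a) set \<Rightarrow> 'a set \<Rightarrow> bool" where
  "strong_on E X \<longleftrightarrow> X \<noteq> {} \<and> (\<forall>u\<in>X. \<forall>v\<in>X. (u, v) \<in> rtrancl_on X E)"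

definition nbrs :: "('a \<times> 'a) set \<Rightarrow> 'a \<Rightarrow> 'a set" where
  "nbrs E x = {y. y \<noteq> x \<and> ((x, y) \<in> E \<or> (y, x) \<in> E)}"

text \<open>The list holds the inner vertices only; the two attachment vertices in \<open>H\<close>
  may coincide. Repetitions are permitted here and get excluded later by minimal length.\<close>

definition ear :: "('a \<times> 'a) set \<Rightarrow> 'a set \<Rightarrow> 'a set \<Rightarrow> 'a list \<Rightarrow> bool" where
  "ear E H Q xs \<longleftrightarrow> xs \<noteq> [] \<and> set xs \<subseteq> Q \<and> successively (\<lambda>x y. (x, y) \<in> E) xs \<and>
     (\<exists>h\<in>H. (h, hd xs) \<in> E) \<and> (\<exists>h\<in>H. (last xs, h) \<in> E)"

lemma strong_onI:
  assumes "p \<in> X" "\<And>v. v \<in> X \<Longrightarrow> (p, v) \<in> rtrancl_on X E" "\<And>v. v \<in> X \<Longrightarrow> (v, p) \<in> rtrancl_on X E"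
  shows "strong_on E X"
  using assms unfolding strong_on_def by (blast intro: rtrancl_on_trans)

lemma strong_on_sing: "strong_on E {v}"
  by (auto simp: strong_on_def)

lemma rtrancl_on_arc: "(a, b) \<in> E \<Longrightarrow> a \<in> X \<Longrightarrow> b \<in> X \<Longrightarrow> (a, b) \<in> rtrancl_on X E"
  by (auto intro: rtrancl_on_into_rtrancl_on)

lemma rtrancl_on_superset: "(a, b) \<in> rtrancl_on X E \<Longrightarrow> X \<subseteq> Y \<Longrightarrow> (a, b) \<in> rtrancl_on Y E"
  by (rule rtrancl_on_mono) auto

text \<open>A vertex on a walk in \<open>Q\<close> between two members of the class is reached from
  \<open>q\<close> and reaches \<open>q\<close>, so it is a member itself and the walk never leaves
  the class.\<close>

lemma strong_on_component:
  assumes "q \<in> Q"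
  shows "strong_on E {x. (q, x) \<in> rtrancl_on Q E \<and> (x, q) \<in> rtrancl_on Q E}" (is "strong_on E ?X")
proof -
  have inner: "(u, v) \<in> rtrancl_on ?X E" if "(u, v) \<in> rtrancl_on Q E" "u \<in> ?X" "v \<in> ?X" for u v
    using that
  proof (induction rule: rtrancl_on_induct)
    case base
    then show ?case by auto
  next
    case (step y z)
    have "(y, z) \<in> rtrancl_on Q E" using step by (intro rtrancl_on_arc)
    then have "y \<in> ?X" using step by (auto intro: rtrancl_on_trans)
    with step show ?case by (blast intro: rtrancl_on_into_rtrancl_on)
  qed
  show ?thesis
    by (rule strong_onI[of q]) (use assms in \<open>auto intro!: inner\<close>)
qed

lemma rtrancl_on_successively:
  assumes "successively (\<lambda>x y. (x, y) \<in> E) xs" "set xs \<subseteq> X" "x \<in> set xs"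
  shows "(hd xs, x) \<in> rtrancl_on X E" "(x, last xs) \<in> rtrancl_on X E"
  using assms
proof (induction xs arbitrary: x)
  case (Cons a xs)
  {
    case 1
    show ?case
    proof (cases "x = a")
      case False
      with 1 have "(a, hd xs) \<in> E" "(hd xs, x) \<in> rtrancl_on X E" "a \<in> X"
        using Cons.IH(1)[of x] by (auto simp: successively_Cons)
      then show ?thesis by (auto intro: converse_rtrancl_on_into_rtrancl_on)
    qed (use 1 in auto)
  next
    case 2
    show ?case
    proof (cases "xs = []")
      case False
      with 2 have a: "(a, hd xs) \<in> E" "a \<in> X" and
        IH: "\<And>y. y \<in> set xs \<Longrightarrow> (y, last xs) \<in> rtrancl_on X E"
        using Cons.IH(2) by (auto simp: successively_Cons)
      have "(a, last xs) \<in> rtrancl_on X E"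
        using a IH[of "hd xs"] False by (auto intro: converse_rtrancl_on_into_rtrancl_on)
      then show ?thesis using False IH 2 by auto
    qed (use 2 in auto)
  }
qed auto

lemma strong_on_ear:
  assumes "strong_on E H" "ear E H Q xs"
  shows "strong_on E (H \<union> set xs)" (is "strong_on E ?X")
proof -
  obtain h k where h: "h \<in> H" "(h, hd xs) \<in> E" and k: "k \<in> H" "(last xs, k) \<in> E"
    using assms(2) by (auto simp: ear_def)
  have suc: "successively (\<lambda>x y. (x, y) \<in> E) xs" "xs \<noteq> []" using assms(2) by (auto simp: ear_def)
  have H: "(u, v) \<in> rtrancl_on ?X E" if "u \<in> H" "v \<in> H" for u v
    using assms(1) that by (auto simp: strong_on_def intro: rtrancl_on_superset)
  show ?thesis
  proof (rule strong_onI[of h])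
    fix v assume "v \<in> ?X"
    then consider "v \<in> H" | "v \<in> set xs" by auto
    then show "(h, v) \<in> rtrancl_on ?X E"
    proof cases
      case 2
      then have "(hd xs, v) \<in> rtrancl_on ?X E" using suc by (intro rtrancl_on_successively) auto
      with h show ?thesis by (auto intro: converse_rtrancl_on_into_rtrancl_on)
    qed (use H h in auto)
    from \<open>v \<in> ?X\<close> consider "v \<in> H" | "v \<in> set xs" by auto
    then show "(v, h) \<in> rtrancl_on ?X E"
    proof cases
      case 2
      then have "(v, last xs) \<in> rtrancl_on ?X E" using suc by (intro rtrancl_on_successively) auto
      then have "(v, k) \<in> rtrancl_on ?X E" using k by (auto intro: rtrancl_on_into_rtrancl_on)
      then show ?thesis using H[of k h] h k by (auto intro: rtrancl_on_trans)
    qed (use H h in auto)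
  qed (use h in auto)
qed

lemma ear_exists:
  assumes "strong_on E V" "H \<subset> V" "H \<noteq> {}"
  shows "\<exists>xs. ear E H (V - H) xs"
proof -
  obtain w h where w: "w \<in> V - H" and h: "h \<in> H" using assms by auto
  have "(h, w) \<in> rtrancl_on V E" "(w, h) \<in> rtrancl_on V E"
    using assms w h by (auto simp: strong_on_def)
  let ?P = "\<lambda>xs. xs \<noteq> [] \<and> set xs \<subseteq> V - H \<and> successively (\<lambda>x y. (x, y) \<in> E) xs \<and>
    (\<exists>h\<in>H. (h, hd xs) \<in> E)"
  \<comment> \<open>The walk from \<open>h\<close> to \<open>w\<close> may return to
    \<open>H\<close>. The implication is vacuous there, and the list restarts at the next vertex
    outside \<open>H\<close>.\<close>
  have "w \<notin> H \<longrightarrow> (\<exists>xs. ?P xs \<and> last xs = w)"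
    using \<open>(h, w) \<in> rtrancl_on V E\<close>
  proof (induction rule: rtrancl_on_induct)
    case (step y z)
    show ?case
    proof (cases "y \<in> H")
      case True
      then show ?thesis using step by (intro impI exI[of _ "[z]"]) auto
    next
      case False
      then obtain xs where "?P xs" "last xs = y" using step by auto
      then show ?thesis using step
        by (intro impI exI[of _ "xs @ [z]"]) (auto simp: successively_append_iff)
    qed
  qed (use h in auto)
  then obtain xs where "?P xs" "last xs = w" using w by auto
  \<comment> \<open>The walk from \<open>w\<close> back to \<open>h\<close> is appended until it
    first enters \<open>H\<close>.\<close>
  with \<open>(w, h) \<in> rtrancl_on V E\<close> have "\<exists>xs. ?P xs \<and> (\<exists>h\<in>H. (last xs, h) \<in> E)"
  proof (induction arbitrary: xs rule: converse_rtrancl_on_induct)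
    case base
    then show ?case using h last_in_set[of xs] by blast
  next
    case (step x y)
    show ?case
    proof (cases "y \<in> H")
      case True
      then show ?thesis using step by blast
    next
      case False
      show ?thesis using step False
        by (intro step.IH[of "xs @ [y]"]) (auto simp: successively_append_iff)
    qed
  qed
  then show ?thesis by (auto simp: ear_def)
qed

section \<open>Search trees with many leaves\<close>

text \<open>\<open>N\<close> consists of the inner vertices of a breadth-first search tree: the children of the root are
  exactly \<open>B\<close>, so every vertex of \<open>N\<close> is the parent of a vertex in \<open>W - B\<close>.\<close>

lemma few_cut_vertices:
  assumes "finite W" "q \<notin> W" "\<And>v. v \<in> W \<Longrightarrow> (q, v) \<in> rtrancl_on (insert q W) E"
  defines "B \<equiv> {v \<in> W. (q, v) \<in> E}"
  obtains N where "N \<subseteq> W" "card N + card B \<le> card W"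
    "\<And>y v. y \<in> W - N \<Longrightarrow> v \<in> W - {y} \<Longrightarrow> (q, v) \<in> rtrancl_on (insert q W - {y}) E"
proof -
  define F where "F = E \<inter> insert q W \<times> insert q W"
  define d where "d v = (LEAST n. (q, v) \<in> F ^^ n)" for v
  have reach: "\<exists>n. (q, v) \<in> F ^^ n" if "v \<in> W" for v
  proof -
    have "(q, v) \<in> F\<^sup>*"
      using assms(3)[OF that] unfolding F_def
      by (induction rule: rtrancl_on_induct) (auto intro: rtrancl_into_rtrancl)
    then show ?thesis by (simp add: rtrancl_power)
  qed
  \<comment> \<open>\<open>d\<close> is the breadth-first distance from \<open>q\<close>. The last
    arc of a shortest walk to \<open>v\<close> starts in \<open>W\<close> and not at
    \<open>q\<close>, because \<open>v\<close> is outside \<open>B\<close>.\<close>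
  have "\<exists>u\<in>W. (u, v) \<in> E \<and> d u < d v" if v: "v \<in> W - B" for v
  proof -
    have "(q, v) \<in> F ^^ d v" using reach[of v] v unfolding d_def by (auto intro: LeastI_ex)
    moreover have "v \<noteq> q" using v assms(2) by auto
    ultimately obtain m where m: "d v = Suc m" by (cases "d v") auto
    then obtain u where u: "(q, u) \<in> F ^^ m" "(u, v) \<in> F"
      using \<open>(q, v) \<in> F ^^ d v\<close> by auto
    then have "d u \<le> m" unfolding d_def by (intro Least_le)
    moreover have "u \<in> W" using u v by (auto simp: F_def B_def)
    ultimately show ?thesis using u m by (auto simp: F_def)
  qed
  then obtain par where par: "\<And>v. v \<in> W - B \<Longrightarrow> par v \<in> W \<and> (par v, v) \<in> E \<and> d (par v) < d v"
    by metis
  define N where "N = par ` (W - B)"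
  have "B \<subseteq> W" by (auto simp: B_def)
  show thesis
  proof
    show "N \<subseteq> W" using par by (auto simp: N_def)
    have "card N \<le> card (W - B)" unfolding N_def using assms(1) by (intro card_image_le) auto
    then show "card N + card B \<le> card W"
      using \<open>B \<subseteq> W\<close> assms(1) card_mono[of W B] by (auto simp: card_Diff_subset finite_subset)
    fix y v assume y: "y \<in> W - N" and "v \<in> W - {y}"
    from \<open>v \<in> W - {y}\<close> show "(q, v) \<in> rtrancl_on (insert q W - {y}) E"
    \<comment> \<open>Following parents from \<open>v\<close> decreases the distance until a vertex
      of \<open>B\<close> is met; \<open>y\<close> is never passed, since it is nobody's
      parent.\<close>
    proof (induction "d v" arbitrary: v rule: less_induct)
      case less
      show ?case
      proof (cases "v \<in> B")
        case True
        then show ?thesis using less y assms(2) by (intro rtrancl_on_arc) (auto simp: B_def)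
      next
        case False
        then have "par v \<noteq> y" using y less by (auto simp: N_def)
        with par[of v] less False have "(q, par v) \<in> rtrancl_on (insert q W - {y}) E" by auto
        then show ?thesis using par[of v] less False by (auto intro: rtrancl_on_into_rtrancl_on)
      qed
    qed
  qed
qed

text \<open>The search trees from \<open>q\<close> and, backwards, from \<open>p\<close> have at
  most \<open>card H - card B\<close> and \<open>card H - card A\<close> inner vertices in
  \<open>H\<close>. These are together fewer than \<open>card H\<close>, so some \<open>y\<close> is
  a leaf of both.\<close>

lemma noncritical_of_short_ear:
  assumes "finite H" "strong_on E H" "p \<notin> H" "q \<notin> H" "(p, q) \<in> E" "p \<noteq> q" "card H \<ge> 2"
    and A: "A = {v \<in> H. (v, p) \<in> E}" and B: "B = {v \<in> H. (q, v) \<in> E}"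
    and "A \<noteq> {}" "B \<noteq> {}" and ab: "card A + card B \<ge> card H + 1"
  shows "\<exists>y\<in>H. strong_on E (H \<union> {p, q} - {y})"
proof -
  have H: "(u, v) \<in> rtrancl_on H E" if "u \<in> H" "v \<in> H" for u v
    using assms(2) that by (auto simp: strong_on_def)
  have 1: "(q, v) \<in> rtrancl_on (insert q H) E" if "v \<in> H" for v
  proof -
    obtain b where b: "b \<in> B" using assms by auto
    then have "(b, v) \<in> rtrancl_on (insert q H) E" using that B
      by (intro rtrancl_on_superset[OF H]) auto
    then show ?thesis using b B by (auto intro: converse_rtrancl_on_into_rtrancl_on)
  qed
  \<comment> \<open>Reversing the arcs turns the in-tree at \<open>p\<close> into an out-tree, so
    \<open>few_cut_vertices\<close> covers it too.\<close>
  have 2: "(p, v) \<in> rtrancl_on (insert p H) (E\<inverse>)" if "v \<in> H" for v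
  proof -
    obtain a where a: "a \<in> A" using assms by auto
    then have "(v, a) \<in> rtrancl_on (insert p H) E" using that A
      by (intro rtrancl_on_superset[OF H]) auto
    then have "(v, p) \<in> rtrancl_on (insert p H) E"
      using a A by (auto intro: rtrancl_on_into_rtrancl_on)
    then show ?thesis by (rule rtrancl_on_converseI)
  qed
  obtain N where N: "N \<subseteq> H" "card N + card B \<le> card H"
    "\<And>y v. y \<in> H - N \<Longrightarrow> v \<in> H - {y} \<Longrightarrow> (q, v) \<in> rtrancl_on (insert q H - {y}) E"
    using few_cut_vertices[OF assms(1) assms(4) 1] unfolding B by blast
  obtain M where M: "M \<subseteq> H" "card M + card A \<le> card H"
    "\<And>y v. y \<in> H - M \<Longrightarrow> v \<in> H - {y} \<Longrightarrow> (p, v) \<in> rtrancl_on (insert p H - {y}) (E\<inverse>)"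
    using few_cut_vertices[OF assms(1) assms(3) 2] unfolding A by auto
  have "card (N \<union> M) < card H" using N(2) M(2) ab card_Un_le[of N M] by linarith
  then have "N \<union> M \<noteq> H" by auto
  then obtain y where y: "y \<in> H" "y \<notin> N" "y \<notin> M" using N(1) M(1) by blast
  let ?X = "H \<union> {p, q} - {y}"
  have from_q: "(q, v) \<in> rtrancl_on ?X E" if "v \<in> H - {y}" for v
    by (rule rtrancl_on_superset[OF N(3)[of y v]]) (use y that in auto)
  have to_p: "(v, p) \<in> rtrancl_on ?X E" if "v \<in> H - {y}" for v
    by (rule rtrancl_on_superset[OF rtrancl_on_converseD[OF M(3)[of y v]]]) (use y that in auto)
  have pq: "(p, q) \<in> rtrancl_on ?X E" using assms y by (intro rtrancl_on_arc) auto
  \<comment> \<open>Since \<open>card H \<ge> 2\<close>, some \<open>w\<close> in \<open>H\<close>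
    survives, and \<open>q\<close> returns to \<open>p\<close> through it.\<close>
  have "card (H - {y}) \<noteq> 0" using assms y by simp
  then obtain w where "w \<in> H - {y}" by (metis card.empty ex_in_conv)
  then have qp: "(q, p) \<in> rtrancl_on ?X E" using from_q to_p rtrancl_on_trans by metis
  have "strong_on E ?X"
  proof (rule strong_onI[of p])
    show "p \<in> ?X" using y assms by auto
    fix v assume v: "v \<in> ?X"
    show "(p, v) \<in> rtrancl_on ?X E"
      using v pq from_q[of v] \<open>p \<in> ?X\<close> by (auto intro: rtrancl_on_trans)
    show "(v, p) \<in> rtrancl_on ?X E"
      using v qp to_p[of v] \<open>p \<in> ?X\<close> by auto
  qed
  with y show ?thesis by blast
qed

section \<open>Shortest ears\<close>

text \<open>Each excluded arc, and each repetition, would allow a piece of the list to be cut out,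
  leaving a strictly shorter ear. Backward arcs along the ear remain possible.\<close>

lemma ear_shortcuts:
  assumes ear: "ear E H Q xs" and min: "\<And>ys. ear E H Q ys \<Longrightarrow> length xs \<le> length ys"
  shows "xs = us @ x # vs \<Longrightarrow> us \<noteq> [] \<Longrightarrow> h \<in> H \<Longrightarrow> (h, x) \<notin> E"
    and "xs = us @ x # vs \<Longrightarrow> vs \<noteq> [] \<Longrightarrow> h \<in> H \<Longrightarrow> (x, h) \<notin> E"
    and "xs = us @ x # ms @ y # vs \<Longrightarrow> ms \<noteq> [] \<Longrightarrow> (x, y) \<notin> E"
    and "distinct xs"
proof -
  show "(h, x) \<notin> E" if "xs = us @ x # vs" "us \<noteq> []" "h \<in> H"
  proof
    assume "(h, x) \<in> E"
    then have "ear E H Q (x # vs)" using ear that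
      by (auto simp: ear_def successively_append_iff)
    from min[OF this] that show False by simp
  qed
  show "(x, h) \<notin> E" if "xs = us @ x # vs" "vs \<noteq> []" "h \<in> H"
  proof
    assume "(x, h) \<in> E"
    then have "ear E H Q (us @ [x])" using ear that
      by (auto simp: ear_def successively_append_iff hd_append)
    from min[OF this] that show False by simp
  qed
  show "(x, y) \<notin> E" if "xs = us @ x # ms @ y # vs" "ms \<noteq> []"
  proof
    assume "(x, y) \<in> E"
    then have "ear E H Q (us @ x # y # vs)" using ear that
      by (auto simp: ear_def successively_append_iff successively_Cons hd_append split: if_splits)
    from min[OF this] that show False by simp
  qed
  show "distinct xs"
  proof (rule ccontr)
    assume "\<not> distinct xs"
    then obtain us x ms vs where xs: "xs = us @ [x] @ ms @ [x] @ vs"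
      using not_distinct_decomp by blast
    then have "ear E H Q (us @ x # vs)" using ear
      by (auto simp: ear_def successively_append_iff successively_Cons hd_append split: if_splits)
    from min[OF this] xs show False by simp
  qed
qed

text \<open>Inclusion-exclusion for the neighbours of the second and third vertices \<open>q\<close>
  and \<open>r\<close>: the union lies in \<open>V - H\<close>, and the intersection in the strong
  component of \<open>q\<close> within \<open>V - H\<close>, which has at most \<open>card H\<close>
  vertices by maximality.\<close>

lemma shortest_ear_length_le_3:
  assumes fin: "finite V" and E: "E \<subseteq> V \<times> V" and HV: "H \<subset> V" "H \<noteq> {}"
    and max: "\<And>X. strong_on E X \<Longrightarrow> X \<subset> V \<Longrightarrow> card X \<le> card H"
    and ear: "ear E H (V - H) xs" and min: "\<And>ys. ear E H (V - H) ys \<Longrightarrow> length xs \<le> length ys"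
    and cover: "set xs = V - H"
    and deg: "\<And>x y. (x, y) \<in> E \<Longrightarrow> x \<noteq> y \<Longrightarrow> card (nbrs E x) + card (nbrs E y) \<ge> card V + 1"
  shows "length xs \<le> 3"
proof (rule ccontr)
  assume "\<not> length xs \<le> 3"
  then obtain p q r s zs where xs: "xs = p # q # r # s # zs"
    by (auto simp: not_le less_eq_Suc_le numeral_eq_Suc Suc_le_length_iff)
  note short = ear_shortcuts[OF ear min]
  have dist: "distinct xs" by (rule short(4))
  have suc: "successively (\<lambda>x y. (x, y) \<in> E) xs" using ear by (auto simp: ear_def)
  have pq: "(p, q) \<in> E" and qr: "(q, r) \<in> E" using suc xs by auto
  have q: "(h, q) \<notin> E" "(q, h) \<notin> E" if "h \<in> H" for h
    using short(1)[of "[p]" q "r # s # zs" h] short(2)[of "[p]" q "r # s # zs" h] that xs by auto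
  have r: "(h, r) \<notin> E" "(r, h) \<notin> E" if "h \<in> H" for h
    using short(1)[of "[p, q]" r "s # zs" h] short(2)[of "[p, q]" r "s # zs" h] that xs by auto
  have pr: "(p, r) \<notin> E" using short(3)[of "[]" p "[q]" r "s # zs"] xs by auto
  have qy: "(q, y) \<notin> E" if y: "y \<in> set (s # zs)" for y
  proof -
    obtain as bs where "s # zs = as @ y # bs" using split_list[OF y] by blast
    then show ?thesis using short(3)[of "[p]" q "r # as" y bs] xs by auto
  qed
  have sub: "nbrs E q \<union> nbrs E r \<subseteq> V - H"
    using q r E by (auto simp: nbrs_def)
  define X where "X = {x. (q, x) \<in> rtrancl_on (V - H) E \<and> (x, q) \<in> rtrancl_on (V - H) E}"
  have inQ: "p \<in> V - H" "q \<in> V - H" "r \<in> V - H" using xs cover by auto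
  have X: "strong_on E X" unfolding X_def using inQ by (intro strong_on_component)
  have "X \<subseteq> V - H" by (auto simp: X_def dest: in_rtrancl_on_in_F)
  then have "X \<subset> V" using HV by auto
  then have cX: "card X \<le> card H" using max X by auto
  \<comment> \<open>There is no arc from \<open>p\<close> to \<open>r\<close>, so a common neighbour
    \<open>p\<close> closes the cycle through \<open>p\<close>, \<open>q\<close>, \<open>r\<close>.
    There is no arc from \<open>q\<close> to a vertex after \<open>r\<close>, so such a neighbour
    has an arc to \<open>q\<close>, while the ear leads from \<open>q\<close> to it.\<close>
  have "nbrs E q \<inter> nbrs E r \<subseteq> X"
  proof
    fix x assume x: "x \<in> nbrs E q \<inter> nbrs E r"
    then have "x \<in> set xs" "x \<noteq> q" "x \<noteq> r" using sub cover by (auto simp: nbrs_def)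
    then consider "x = p" | "x \<in> set (s # zs)" using xs by auto
    then show "x \<in> X"
    proof cases
      case 1
      then have "(r, p) \<in> E" using x pr by (auto simp: nbrs_def)
      then have "(r, p) \<in> rtrancl_on (V - H) E" using inQ by (intro rtrancl_on_arc)
      then show ?thesis using 1 inQ pq qr
        by (auto simp: X_def intro: rtrancl_on_arc converse_rtrancl_on_into_rtrancl_on)
    next
      case 2
      then have "(x, q) \<in> E" using x qy by (auto simp: nbrs_def)
      moreover have "x \<in> V - H" using 2 xs cover by auto
      moreover have "(hd (q # r # s # zs), x) \<in> rtrancl_on (V - H) E"
        using suc 2 xs cover by (intro rtrancl_on_successively(1)) auto
      ultimately show ?thesis using inQ by (auto simp: X_def intro: rtrancl_on_arc)
    qed
  qed
  then have "card (nbrs E q \<inter> nbrs E r) \<le> card H"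
    using cX card_mono[of X "nbrs E q \<inter> nbrs E r"] \<open>X \<subset> V\<close> fin finite_subset by fastforce
  moreover have "card (nbrs E q \<union> nbrs E r) \<le> card (V - H)"
    using sub fin by (intro card_mono) auto
  moreover have "card (V - H) + card H = card V"
    using HV fin by (metis card_Diff_subset card_mono finite_subset le_add_diff_inverse2 psubset_imp_subset)
  moreover have "card (nbrs E q) + card (nbrs E r)
      = card (nbrs E q \<union> nbrs E r) + card (nbrs E q \<inter> nbrs E r)"
    using sub fin by (intro card_Un_Int) (auto intro: finite_subset)
  ultimately show False using deg[OF qr] dist xs by auto
qed

section \<open>Case distinction on the length of the ear\<close>

lemma noncritical_exists:
  assumes fin: "finite V" and E: "E \<subseteq> V \<times> V" and V: "strong_on E V" "card V \<ge> 4"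
    and deg: "\<And>x y. (x, y) \<in> E \<Longrightarrow> x \<noteq> y \<Longrightarrow> card (nbrs E x) + card (nbrs E y) \<ge> card V + 1"
  shows "\<exists>v\<in>V. strong_on E (V - {v})"
proof -
  let ?P = "\<lambda>X. strong_on E X \<and> X \<subset> V"
  obtain v where "v \<in> V" using V by (auto simp: strong_on_def)
  then have "?P {v}" using V(2) strong_on_sing[of E v] by auto
  moreover have "\<forall>X. ?P X \<longrightarrow> card X < card V" using fin by (auto intro: psubset_card_mono)
  ultimately have "\<exists>X. ?P X \<and> (\<forall>Y. ?P Y \<longrightarrow> card Y \<le> card X)"
    by (rule ex_has_greatest_nat)
  then obtain H where H: "strong_on E H" "H \<subset> V"
    and max: "\<And>X. strong_on E X \<Longrightarrow> X \<subset> V \<Longrightarrow> card X \<le> card H"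
    by auto
  have Hne: "H \<noteq> {}" using H by (auto simp: strong_on_def)
  have finH: "finite H" using fin H finite_subset by blast
  obtain xs0 where "ear E H (V - H) xs0" using ear_exists[OF V(1) H(2) Hne] by blast
  then have "\<exists>xs. ear E H (V - H) xs \<and> (\<forall>ys. ear E H (V - H) ys \<longrightarrow> length xs \<le> length ys)"
    by (rule ex_has_least_nat)
  then obtain xs where ear: "ear E H (V - H) xs"
    and min: "\<And>ys. ear E H (V - H) ys \<Longrightarrow> length xs \<le> length ys"
    by auto
  note short = ear_shortcuts[OF ear min]
  have dist: "distinct xs" by (rule short(4))
  have "set xs \<subseteq> V - H" "xs \<noteq> []" using ear by (auto simp: ear_def)
  have cover: "set xs = V - H"
  proof (rule ccontr)
    assume "set xs \<noteq> V - H"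
    then have "card (H \<union> set xs) \<le> card H"
      using \<open>set xs \<subseteq> V - H\<close> H by (intro max strong_on_ear[OF H(1) ear]) auto
    moreover have "card (H \<union> set xs) = card H + card (set xs)"
      using \<open>set xs \<subseteq> V - H\<close> finH by (intro card_Un_disjoint) auto
    ultimately show False using \<open>xs \<noteq> []\<close> by simp
  qed
  have "card V = card H + card (set xs)"
    using H fin finH cover by (metis card_Diff_subset card_mono le_add_diff_inverse psubset_imp_subset)
  then have cV: "card V = card H + length xs" using dist by (simp add: distinct_card)
  have Veq: "V = H \<union> set xs" using cover H by auto
  have nbV: "nbrs E x \<subseteq> V - {x}" for x using E by (auto simp: nbrs_def)
  have suc: "successively (\<lambda>x y. (x, y) \<in> E) xs" using ear by (auto simp: ear_def)
  have "length xs \<le> 3"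
    by (rule shortest_ear_length_le_3[OF fin E H(2) Hne _ ear _ cover]) (fact max min deg)+
  with \<open>xs \<noteq> []\<close> consider p where "xs = [p]" | p q where "xs = [p, q]" | p q r where "xs = [p, q, r]"
    by (auto simp: numeral_3_eq_3 le_Suc_eq length_Suc_conv)
  then show ?thesis
  proof cases
    case (1 p)
    then have "V - {p} = H" "p \<in> V" using cover H by auto
    then show ?thesis using H by auto
  next
    case (2 p q)
    define A where "A = {v \<in> H. (v, p) \<in> E}"
    define B where "B = {v \<in> H. (q, v) \<in> E}"
    have pq: "(p, q) \<in> E" "p \<noteq> q" "p \<notin> H" "q \<notin> H" using 2 suc dist cover by auto
    have p: "(p, h) \<notin> E" if "h \<in> H" for h using short(2)[of "[]" p "[q]" h] 2 that by auto
    have q: "(h, q) \<notin> E" if "h \<in> H" for h using short(1)[of "[p]" q "[]" h] 2 that by auto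
    \<comment> \<open>An arc from \<open>p\<close> into \<open>H\<close> or from \<open>H\<close> to
      \<open>q\<close> would shorten the ear, so only arcs counted by \<open>A\<close> and
      \<open>B\<close> join the ear to \<open>H\<close>.\<close>
    have "nbrs E p \<subseteq> insert q A" "nbrs E q \<subseteq> insert p B"
      using nbV[of p] nbV[of q] p q 2 Veq by (auto simp: nbrs_def A_def B_def)
    moreover have fAB: "finite A" "finite B" using finH by (auto simp: A_def B_def)
    ultimately have "card (nbrs E p) \<le> card (insert q A)" "card (nbrs E q) \<le> card (insert p B)"
      by (auto intro!: card_mono)
    moreover have "card (insert q A) \<le> Suc (card A)" "card (insert p B) \<le> Suc (card B)"
      by (auto simp: card_insert_le_m1 card_insert_if fAB)
    \<comment> \<open>Here \<open>card V + 1 = card H + 3\<close>, and the two degrees sum to at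
      most \<open>card A + card B + 2\<close>.\<close>
    ultimately have "card A + card B \<ge> card H + 1" using deg[of p q] pq cV 2 by auto
    moreover have "card H \<ge> 2" using cV V(2) 2 by simp
    moreover have "A \<noteq> {}" "B \<noteq> {}" using ear 2 by (auto simp: ear_def A_def B_def)
    ultimately have "\<exists>y\<in>H. strong_on E (H \<union> {p, q} - {y})"
      using noncritical_of_short_ear[OF finH H(1) pq(3,4,1,2) _ A_def B_def] by blast
    then show ?thesis using 2 Veq by auto
  next
    case (3 p q r)
    have arcs: "(p, q) \<in> E" "(q, r) \<in> E" using 3 suc by auto
    have dis: "p \<noteq> q" "q \<noteq> r" "p \<noteq> r" "p \<notin> H" "q \<notin> H" "r \<notin> H" using 3 dist cover by auto
    have p: "(p, h) \<notin> E" if "h \<in> H" for h using short(2)[of "[]" p "[q,r]" h] 3 that by auto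
    have q: "(h, q) \<notin> E" "(q, h) \<notin> E" if "h \<in> H" for h
      using short(1)[of "[p]" q "[r]" h] short(2)[of "[p]" q "[r]" h] 3 that by auto
    have r: "(h, r) \<notin> E" if "h \<in> H" for h using short(1)[of "[p,q]" r "[]" h] 3 that by auto
    have pr: "(p, r) \<notin> E" using short(3)[of "[]" p "[q]" r "[]"] 3 by auto
    have "nbrs E q \<subseteq> {p, r}" using nbV[of q] q 3 Veq by (auto simp: nbrs_def)
    then have "card (nbrs E q) \<le> card {p, r}" by (intro card_mono) auto
    then have dq: "card (nbrs E q) \<le> 2" using dis by simp
    have full: "nbrs E x = V - {x}" if "card (nbrs E x) \<ge> card V - 1" "x \<in> V" for x
      by (rule card_seteq[OF _ nbV]) (use that fin in auto)
    \<comment> \<open>As \<open>q\<close> has degree at most 2, the degree condition forces the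
      largest possible degree on \<open>p\<close> and \<open>r\<close>.\<close>
    have "card (nbrs E p) \<ge> card V - 1" "card (nbrs E r) \<ge> card V - 1"
      using deg[OF arcs(1) dis(1)] deg[OF arcs(2) dis(2)] dq by linarith+
    moreover have "p \<in> V" "r \<in> V" using 3 Veq by auto
    ultimately have full_p: "nbrs E p = V - {p}" and full_r: "nbrs E r = V - {r}"
      using full by blast+
    have nb: "y \<in> nbrs E p" "y \<in> nbrs E r" if "y \<in> H" for y
      unfolding full_p full_r using Veq that dis by auto
    have "p \<in> nbrs E r" unfolding full_r using 3 Veq dis by auto
    then have rp: "(r, p) \<in> E" using pr by (auto simp: nbrs_def)
    have hp: "(h, p) \<in> E" and rh: "(r, h) \<in> E" if "h \<in> H" for h
      using nb[OF that] p[OF that] r[OF that] by (auto simp: nbrs_def)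
    \<comment> \<open>Any \<open>x\<close> works: each remaining \<open>h\<close> in
      \<open>H\<close> lies on the closed walk \<open>p\<close>, \<open>q\<close>, \<open>r\<close>,
      \<open>h\<close>, \<open>p\<close>, and the arc from \<open>r\<close> to \<open>p\<close>
      closes the triangle on the ear.\<close>
    obtain x where x: "x \<in> H" using Hne by auto
    let ?X = "V - {x}"
    have in_X: "p \<in> ?X" "q \<in> ?X" "r \<in> ?X" using 3 Veq x dis by auto
    have pr': "(p, r) \<in> rtrancl_on ?X E" and qp: "(q, p) \<in> rtrancl_on ?X E"
      using in_X arcs rp by (meson rtrancl_on_arc rtrancl_on_into_rtrancl_on)+
    have "strong_on E ?X"
    proof (rule strong_onI[OF in_X(1)])
      fix v assume v: "v \<in> ?X"
      then consider "v = p" | "v = q" | "v = r" | "v \<in> H" using Veq 3 by auto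
      note v_cases = this
      show "(p, v) \<in> rtrancl_on ?X E"
        using v_cases by cases
          (use in_X arcs pr' rh v in \<open>auto intro: rtrancl_on_arc rtrancl_on_into_rtrancl_on\<close>)
      show "(v, p) \<in> rtrancl_on ?X E"
        using v_cases by cases (use in_X qp rp hp v in \<open>auto intro: rtrancl_on_arc\<close>)
    qed
    then show ?thesis using x Veq by auto
  qed
qed

section \<open>Transfer to digraphs\<close>

lemma strongly_connected_iff_strong_on:
  "strongly_connected D \<longleftrightarrow> strong_on (arcs_ends D) (verts D)"
  by (simp add: strongly_connected_def strong_on_def reachable_def)

text \<open>A walk confined to the vertices other than \<open>v\<close> uses no arc incident to
  \<open>v\<close>, so all its arcs survive the deletion.\<close>

lemma strongly_connected_del_vert:
  assumes "strong_on (arcs_ends D) (verts D - {v})"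
  shows "strongly_connected (pre_digraph.del_vert D v)"
proof -
  let ?D = "pre_digraph.del_vert D v"
  have "(a, b) \<in> rtrancl_on (verts D - {v}) (arcs_ends ?D)"
    if "(a, b) \<in> rtrancl_on (verts D - {v}) (arcs_ends D)" for a b
    using that
  proof (induction rule: rtrancl_on_induct)
    case (step y z)
    then have "(y, z) \<in> arcs_ends ?D"
      by (auto simp: arcs_ends_def arc_to_ends_def pre_digraph.del_vert_def)
    with step show ?case by (auto intro: rtrancl_on_into_rtrancl_on)
  qed auto
  then show ?thesis using assms
    by (auto simp: strongly_connected_iff_strong_on strong_on_def pre_digraph.del_vert_def)
qed

theorem theorem1:
  fixes D :: "('a, 'b) pre_digraph" and n :: nat
  assumes "digraph D"
    and "strongly_connected D"
    and "card (verts D) = n"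
    and "n \<ge> 4"
    and "\<And>x y. adjacent D x y \<Longrightarrow> vdeg D x + vdeg D y \<ge> n + 1"
  shows "\<exists>v. noncritical D v"
proof -
  interpret digraph D by (rule assms(1))
  have E: "arcs_ends D \<subseteq> verts D \<times> verts D" by (auto simp: arcs_ends_def arc_to_ends_def)
  \<comment> \<open>Both ends of every arc are vertices, so \<open>adjacent\<close> and
    \<open>nbrs\<close> yield the same neighbours.\<close>
  have "vdeg D x = card (nbrs (arcs_ends D) x)" for x
    unfolding vdeg_def nbrs_def adjacent_def using E by (intro arg_cong[where f = card]) auto
  then have "\<exists>v\<in>verts D. strong_on (arcs_ends D) (verts D - {v})"
    using assms E by (intro noncritical_exists)
      (auto simp: strongly_connected_iff_strong_on adjacent_def)
  then show ?thesis by (auto simp: noncritical_def intro: strongly_connected_del_vert)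
qed

end
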